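(* Let $L\ge 1$, let $f:\mathbb{R}^d\to\mathbb{R}$ be $L$-smooth with a minimizer $x^*$, and let $0<h\le \frac{1}{\sqrt{L}}$. Let $(x_k)_{k\ge 0}$ be the iterates of the algorithm HF-opt with constant integration time $\eta_k=h$ for all $k$, started from an arbitrary $x_0\in\mathbb{R}^d$. Then: (1) If $f$ is $\alpha$-gradient-dominated with $0<\alpha\le 1$, then for all $k\ge 0$, $f(x_k)-f(x^* )\le \left(1-\tfrac12\alpha h^2\right)^k\,(f(x_0)-f(x^* ))$. (2) If $f$ is (weakly) convex, then for all $k\ge 1$, $f(x_k)-f(x^* )\le \dfrac{34\,\|x_0-x^*\|^2}{h^2k}$.
   Context: $\|\cdot\|$ is the Euclidean norm on $\mathbb{R}^d$. A differentiable $f$ is $L$-smooth if $\|\nabla f(x)-\nabla f(y)\|\le L\|x-y\|$ for all $x,y\in\mathbb{R}^d$. It is $\alpha$-gradient-dominated if $\|\nabla f(x)\|^2\ge 2\alpha\,(f(x)-f(x^* ))$ for all $x$, where $x^*$ is a minimizer of $f$. It is weakly convex if it is convex: $f(y)\ge f(x)+\langle\nabla f(x),y-x\rangle$ for all $x,y$. Hamiltonian flow: the ODE system $\dot X_t=Y_t$, $\dot Y_t=-\nabla f(X_t)$ on $\mathbb{R}^d\times\mathbb{R}^d$. The flow map $\mathsf{HF}_\eta(X_0,Y_0)=(X_\eta,Y_\eta)$ is its solution at time $\eta$ started from $(X_0,Y_0)$. Let $\Pi_1(x,y)=x$. HF-opt with integration times $\eta_k>0$: from $x_0\in\mathbb{R}^d$,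 set $x_{k+1}=\Pi_1(\mathsf{HF}_{\eta_k}(x_k,0))$ for $k=0,1,2,\dots$ (the velocity is reset to $0$ at the start of each step). *)

theory Defs
  imports "HOL-Analysis.Analysis"
begin

text \<open>Meaningful where \<open>f\<close> is differentiable; see \<open>GDERIV_gradient\<close> below.\<close>

definition gradient :: "('a::euclidean_space \<Rightarrow> real) \<Rightarrow> 'a \<Rightarrow> 'a" where
  "gradient f x = (THE g. GDERIV f x :> g)"

lemma gradient_eqI:
  assumes "GDERIV f x :> g"
  shows "gradient f x = g"
  unfolding gradient_def
proof (rule the_equality)
  fix g' assume "GDERIV f x :> g'"
  with assms have "(\<lambda>h. inner h g') = (\<lambda>h. inner h g)"
    unfolding gderiv_def by (rule has_derivative_unique[rotated])
  then have "\<And>h. inner h g' = inner h g" by metis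
  then show "g' = g"
    by (auto intro: euclidean_eqI simp: inner_commute)
qed (fact assms)

lemma GDERIV_gradient:
  fixes f :: "'a::euclidean_space \<Rightarrow> real"
  assumes "f differentiable (at x)"
  shows "GDERIV f x :> gradient f x"
proof -
  from assms obtain D where D: "(f has_derivative D) (at x)"
    unfolding differentiable_def by blast
  then interpret bounded_linear D by (rule has_derivative_bounded_linear)
  have "D h = inner h (\<Sum>b\<in>Basis. D b *\<^sub>R b)" for h
  proof -
    have "D h = D (\<Sum>b\<in>Basis. inner h b *\<^sub>R b)"
      by (simp add: euclidean_representation)
    then show ?thesis
      by (simp add: sum scaleR inner_sum_right mult.commute)
  qed
  then have "D = (\<lambda>h. inner h (\<Sum>b\<in>Basis. D b *\<^sub>R b))" by blast
  with D have "GDERIV f x :> (\<Sum>b\<in>Basis. D b *\<^sub>R b)"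
    unfolding gderiv_def by metis
  with gradient_eqI[OF this] show ?thesis by simp
qed

definition L_smooth :: "real \<Rightarrow> ('a::euclidean_space \<Rightarrow> real) \<Rightarrow> bool" where
  "L_smooth L f \<longleftrightarrow>
     f differentiable_on UNIV \<and>
     (\<forall>x y. norm (gradient f x - gradient f y) \<le> L * norm (x - y))"

definition is_minimizer :: "('a \<Rightarrow> real) \<Rightarrow> 'a \<Rightarrow> bool" where
  "is_minimizer f xs \<longleftrightarrow> (\<forall>x. f xs \<le> f x)"

text \<open>The choice of the minimizer \<open>xs\<close> is immaterial, as only the value \<open>f xs\<close> enters.\<close>

definition gradient_dominated ::
    "real \<Rightarrow> ('a::euclidean_space \<Rightarrow> real) \<Rightarrow> 'a \<Rightarrow> bool" where
  "gradient_dominated \<alpha> f xs \<longleftrightarrow>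
     f differentiable_on UNIV \<and> is_minimizer f xs \<and>
     (\<forall>x. (norm (gradient f x))\<^sup>2 \<ge> 2 * \<alpha> * (f x - f xs))"

definition weakly_convex :: "('a::euclidean_space \<Rightarrow> real) \<Rightarrow> bool" where
  "weakly_convex f \<longleftrightarrow>
     f differentiable_on UNIV \<and>
     (\<forall>x y. f y \<ge> f x + inner (gradient f x) (y - x))"

text \<open>Solutions on the time interval \<open>[0, \<eta>]\<close>, with one-sided derivatives at its endpoints.\<close>

definition hamiltonian_solution ::
    "('a::euclidean_space \<Rightarrow> real) \<Rightarrow> real \<Rightarrow> (real \<Rightarrow> 'a) \<Rightarrow> (real \<Rightarrow> 'a) \<Rightarrow> bool" where
  "hamiltonian_solution f \<eta> X Y \<longleftrightarrow>
     (\<forall>t\<in>{0..\<eta>}.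
        (X has_vector_derivative Y t) (at t within {0..\<eta>}) \<and>
        (Y has_vector_derivative - gradient f (X t)) (at t within {0..\<eta>}))"

text \<open>
  The flow map for times \<open>\<eta> \<ge> 0\<close>. If the gradient of \<open>f\<close> is Lipschitz, the solution on
  \<open>[0, \<eta>]\<close> exists and is unique (Picard-Lindeloef), so the description denotes its endpoint.
\<close>

definition HF :: "('a::euclidean_space \<Rightarrow> real) \<Rightarrow> real \<Rightarrow> 'a \<times> 'a \<Rightarrow> 'a \<times> 'a" where
  "HF f \<eta> z =
     (THE w. \<exists>X Y. hamiltonian_solution f \<eta> X Y \<and> (X 0, Y 0) = z \<and> w = (X \<eta>, Y \<eta>))"

primrec HF_opt ::
    "('a::euclidean_space \<Rightarrow> real) \<Rightarrow> (nat \<Rightarrow> real) \<Rightarrow> 'a \<Rightarrow> nat \<Rightarrow> 'a" where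
  "HF_opt f \<eta> x0 0 = x0"
| "HF_opt f \<eta> x0 (Suc k) = fst (HF f (\<eta> k) (HF_opt f \<eta> x0 k, 0))"

end

theory Submission
  imports Defs
begin

text \<open>
  Each step starts at rest, so conservation of energy turns the decrease of \<open>f\<close> along the step
  into half the square of the final velocity. Over a time \<open>h\<close> with \<open>L * h\<^sup>2 \<le> 1\<close> the force
  hardly changes: the trajectory stays close to the parabola of constant acceleration
  \<open>- gradient f x\<close> (\<open>trajectory_from_rest_bounds\<close>), and the final velocity is close to
  \<open>- h *\<^sub>R gradient f x\<close>. Hence one step lowers \<open>f\<close> by at least
  \<open>h\<^sup>2 * (norm (gradient f x))\<^sup>2 / 4\<close> (\<open>sufficient_decrease\<close>), as a gradient step of length
  of order \<open>h\<^sup>2\<close> would.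

  Gradient domination bounds the squared gradient below by a multiple of the optimality gap,
  so the gap contracts by the factor \<open>1 - \<alpha> * h\<^sup>2 / 2\<close>.

  For convex \<open>f\<close> the squared distance to the minimizer is differentiated twice along the
  trajectory. Smoothness bounds the squared gradient by the optimality gap, which makes the pull
  towards the minimizer outweigh, on average over the step, the kinetic energy that could carry
  the trajectory past it (\<open>distance_to_minimizer_nonincreasing\<close>). With the distance bounded
  by its initial value \<open>D\<close>, convexity gives a gap of at most \<open>norm (gradient f x) * D\<close>,
  and the decrease per step is at least the squared gap divided by \<open>4 * D\<^sup>2 / h\<^sup>2\<close>; such a
  sequence decays like \<open>4 * D\<^sup>2 / (h\<^sup>2 * k)\<close> (\<open>inverse_linear_decay\<close>).

  The flow map is a definite description, so these facts apply to the iterates only once the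
  Hamiltonian system is known to have exactly one solution on \<open>[0, h]\<close>. The same smallness of
  \<open>h\<close> makes the integral form of the system a contraction.
\<close>

section \<open>Comparison of derivatives\<close>

lemma norm_increment_le_of_derivative_le:
  fixes F :: "real \<Rightarrow> 'a::real_normed_vector" and \<phi> :: "real \<Rightarrow> real"
  assumes F: "\<And>s. s \<in> {0..\<eta>} \<Longrightarrow> (F has_vector_derivative F' s) (at s within {0..\<eta>})"
    and \<phi>: "\<And>s. (\<phi> has_real_derivative \<phi>' s) (at s)"
    and le: "\<And>s. s \<in> {0..\<eta>} \<Longrightarrow> norm (F' s) \<le> \<phi>' s"
    and t: "t \<in> {0..\<eta>}"
  shows "norm (F t - F 0) \<le> \<phi> t - \<phi> 0"
proof (cases "t = 0")
  case False
  show ?thesis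
  proof (rule differentiable_bound_general)
    show "0 < t" using t False by auto
    have "continuous_on {0..\<eta>} F"
      using F by (meson continuous_on_vector_derivative)
    then show "continuous_on {0..t} F"
      using t by (auto elim: continuous_on_subset)
    show "continuous_on {0..t} \<phi>"
      using \<phi> by (meson DERIV_continuous continuous_at_imp_continuous_on)
    fix s assume s: "0 < s" "s < t"
    have "at s within {0..\<eta>} = at s"
      using s t by (intro at_within_Icc_at) auto
    then show "(F has_vector_derivative F' s) (at s)"
      using F[of s] s t by auto
    show "(\<phi> has_vector_derivative \<phi>' s) (at s)"
      using \<phi> by (simp add: has_real_derivative_iff_has_vector_derivative)
    show "norm (F' s) \<le> \<phi>' s"
      using le s t by auto
  qed
qed simp

lemma increment_le_of_derivative_le:
  fixes p \<phi> :: "real \<Rightarrow> real"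
  assumes p: "\<And>s. s \<in> {0..\<eta>} \<Longrightarrow> (p has_real_derivative p' s) (at s within {0..\<eta>})"
    and \<phi>: "\<And>s. (\<phi> has_real_derivative \<phi>' s) (at s)"
    and le: "\<And>s. s \<in> {0..\<eta>} \<Longrightarrow> p' s \<le> \<phi>' s"
    and t: "t \<in> {0..\<eta>}"
  shows "p t - p 0 \<le> \<phi> t - \<phi> 0"
proof (cases "t = 0")
  case False
  then have "0 < t" using t by auto
  let ?d = "\<lambda>s. p s - \<phi> s"
  have "(?d has_derivative (\<lambda>u. (p' s - \<phi>' s) * u)) (at s within {0..t})"
    if "0 \<le> s" "s \<le> t" for s
  proof -
    have "(?d has_real_derivative p' s - \<phi>' s) (at s within {0..\<eta>})"
      using p[of s] has_field_derivative_at_within[OF \<phi>[of s], of "{0..\<eta>}"] that t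
      by (intro DERIV_diff) auto
    then show ?thesis
      using t by (auto simp: has_field_derivative_def intro: has_derivative_subset)
  qed
  from mvt_simple[OF \<open>0 < t\<close>, of ?d, OF this]
  obtain s where s: "s \<in> {0<..<t}" "?d t - ?d 0 = (p' s - \<phi>' s) * (t - 0)"
    by auto
  have "(p' s - \<phi>' s) * (t - 0) \<le> 0"
    using le[of s] s t by (intro mult_nonpos_nonneg) auto
  with s show ?thesis by simp
qed simp

text \<open>
  The case \<open>n = 0\<close> serves the contraction and Gronwall arguments below; the case \<open>n = 2\<close>
  sharpens the Gronwall bound, which is quadratic in time, when it is fed back into the equation.
\<close>

lemma second_derivative_monomial_bound:
  fixes X Y Z :: "real \<Rightarrow> 'a::real_normed_vector"
  assumes X: "\<And>s. s \<in> {0..\<eta>} \<Longrightarrow> (X has_vector_derivative Y s) (at s within {0..\<eta>})"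
    and Y: "\<And>s. s \<in> {0..\<eta>} \<Longrightarrow> (Y has_vector_derivative Z s) (at s within {0..\<eta>})"
    and init: "X 0 = 0" "Y 0 = 0"
    and le: "\<And>s. s \<in> {0..\<eta>} \<Longrightarrow> norm (Z s) \<le> K * s ^ n"
    and t: "t \<in> {0..\<eta>}"
  shows "norm (Y t) \<le> K * t ^ (n + 1) / (n + 1)"
    and "norm (X t) \<le> K * t ^ (n + 2) / ((n + 1) * (n + 2))"
proof -
  have power: "((\<lambda>s. c * s ^ (m + 1) / (m + 1)) has_real_derivative c * s ^ m) (at s)"
    for c s :: real and m :: nat
    using DERIV_cmult[OF DERIV_pow[of "m + 1" s], of "c / (m + 1)"]
    by (simp del: of_nat_add of_nat_Suc)
  have 1: "norm (Y s) \<le> K * s ^ (n + 1) / (n + 1)" if "s \<in> {0..\<eta>}" for s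
    using norm_increment_le_of_derivative_le[OF Y power le that] by (simp add: init)
  then show "norm (Y t) \<le> K * t ^ (n + 1) / (n + 1)"
    using t by blast
  have "norm (Y s) \<le> K / (n + 1) * s ^ (n + 1)" if "s \<in> {0..\<eta>}" for s
    using 1[OF that] by simp
  from norm_increment_le_of_derivative_le[OF X power this t]
  show "norm (X t) \<le> K * t ^ (n + 2) / ((n + 1) * (n + 2))"
    by (simp add: init algebra_simps)
qed

text \<open>
  A Gronwall estimate for second-order equations on short time intervals. If \<open>M\<close> is the
  maximum of \<open>norm X\<close>, integrating twice gives \<open>M \<le> (L * M + G) * \<eta>\<^sup>2 / 2\<close>, and
  \<open>L * \<eta>\<^sup>2 \<le> 1\<close> absorbs half of \<open>M\<close>; hence \<open>L * M \<le> G\<close> and the second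
  derivative is at most \<open>2 * G\<close>. With \<open>G = 0\<close> this is uniqueness of solutions.
\<close>

lemma second_order_gronwall:
  fixes X Y Z :: "real \<Rightarrow> 'a::real_normed_vector"
  assumes X: "\<And>s. s \<in> {0..\<eta>} \<Longrightarrow> (X has_vector_derivative Y s) (at s within {0..\<eta>})"
    and Y: "\<And>s. s \<in> {0..\<eta>} \<Longrightarrow> (Y has_vector_derivative Z s) (at s within {0..\<eta>})"
    and init: "X 0 = 0" "Y 0 = 0"
    and le: "\<And>s. s \<in> {0..\<eta>} \<Longrightarrow> norm (Z s) \<le> L * norm (X s) + G"
    and L: "0 \<le> L" "L * \<eta>\<^sup>2 \<le> 1" and G: "0 \<le> G"
    and t: "t \<in> {0..\<eta>}"
  shows "norm (X t) \<le> G * t\<^sup>2"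
proof -
  have "continuous_on {0..\<eta>} X"
    using X by (meson continuous_on_vector_derivative)
  then have "\<exists>m\<in>{0..\<eta>}. \<forall>s\<in>{0..\<eta>}. norm (X s) \<le> norm (X m)"
    using t by (intro continuous_attains_sup continuous_on_norm) auto
  then obtain m where m: "m \<in> {0..\<eta>}" "\<And>s. s \<in> {0..\<eta>} \<Longrightarrow> norm (X s) \<le> norm (X m)"
    by blast
  define M where "M = norm (X m)"
  have "norm (Z s) \<le> (L * M + G) * s ^ 0" if "s \<in> {0..\<eta>}" for s
    using le[OF that] mult_left_mono[OF m(2)[OF that] L(1)] by (simp add: M_def)
  from second_derivative_monomial_bound(2)[OF X Y init this]
  have X_le: "norm (X s) \<le> (L * M + G) * s\<^sup>2 / 2" if "s \<in> {0..\<eta>}" for s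
    using that by (simp add: power2_eq_square)
  have m2: "m\<^sup>2 \<le> \<eta>\<^sup>2"
    using m by (intro power_mono) auto
  have "M \<le> (L * M + G) * m\<^sup>2 / 2"
    using X_le[OF m(1)] by (simp add: M_def)
  also have "\<dots> \<le> (L * M + G) * \<eta>\<^sup>2 / 2"
    using m2 L G by (intro divide_right_mono mult_left_mono) (auto simp: M_def)
  also have "\<dots> = (L * \<eta>\<^sup>2) * M / 2 + G * \<eta>\<^sup>2 / 2"
    by (simp add: algebra_simps)
  also have "\<dots> \<le> 1 * M / 2 + G * \<eta>\<^sup>2 / 2"
    using L by (intro add_right_mono divide_right_mono mult_right_mono) (auto simp: M_def)
  finally have "M \<le> G * \<eta>\<^sup>2" by simp
  from mult_left_mono[OF this L(1)] have "L * M \<le> G * (L * \<eta>\<^sup>2)"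
    by (simp add: algebra_simps)
  also have "\<dots> \<le> G"
    using mult_left_mono[OF L(2) G] by simp
  finally have "(L * M + G) * t\<^sup>2 / 2 \<le> (2 * G) * t\<^sup>2 / 2"
    by (intro divide_right_mono mult_right_mono) auto
  with X_le[OF t] show ?thesis by simp
qed

section \<open>Smooth functions\<close>

lemma L_smooth_GDERIV:
  assumes "L_smooth L f"
  shows "GDERIV f x :> gradient f x"
  using assms by (intro GDERIV_gradient) (auto simp: L_smooth_def differentiable_on_def)

lemma L_smooth_gradient_lipschitz:
  assumes "L_smooth L f"
  shows "norm (gradient f x - gradient f y) \<le> L * norm (x - y)"
  using assms by (simp add: L_smooth_def)

lemma L_smooth_continuous_on_gradient:
  assumes "L_smooth L f" "0 \<le> L"
  shows "continuous_on S (gradient f)"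
proof -
  have "L-lipschitz_on S (gradient f)"
    using assms by (intro lipschitz_onI) (auto simp: dist_norm L_smooth_gradient_lipschitz)
  then show ?thesis by (rule lipschitz_on_continuous_on)
qed

lemma has_real_derivative_along_curve:
  fixes f :: "'a::euclidean_space \<Rightarrow> real"
  assumes "GDERIV f (X t) :> g" "(X has_vector_derivative v) (at t within S)"
  shows "((\<lambda>s. f (X s)) has_real_derivative inner v g) (at t within S)"
proof -
  have "((\<lambda>s. f (X s)) has_derivative (\<lambda>u. inner (u *\<^sub>R v) g)) (at t within S)"
    using has_derivative_compose[OF assms(2)[unfolded has_vector_derivative_def]
        assms(1)[unfolded gderiv_def]] .
  then show ?thesis
    by (simp add: has_field_derivative_def mult_commute_abs)
qed

lemma L_smooth_descent:
  fixes f :: "'a::euclidean_space \<Rightarrow> real"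
  assumes f: "L_smooth L f"
  shows "f (x + d) \<le> f x + inner d (gradient f x) + L / 2 * (norm d)\<^sup>2"
proof -
  have "((\<lambda>s. f (x + s *\<^sub>R d)) has_real_derivative inner d (gradient f (x + s *\<^sub>R d)))
      (at s within {0..1})" for s
    by (rule has_real_derivative_along_curve[OF L_smooth_GDERIV[OF f]])
      (auto intro!: derivative_eq_intros)
  moreover have "((\<lambda>s. s * inner d (gradient f x) + L / 2 * s\<^sup>2 * (norm d)\<^sup>2) has_real_derivative
      inner d (gradient f x) + L * s * (norm d)\<^sup>2) (at s)" for s
    by (rule derivative_eq_intros refl)+ simp
  moreover have "inner d (gradient f (x + s *\<^sub>R d)) \<le> inner d (gradient f x) + L * s * (norm d)\<^sup>2"
    if "s \<in> {0..1}" for s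
  proof -
    have "inner d (gradient f (x + s *\<^sub>R d) - gradient f x)
        \<le> norm d * norm (gradient f (x + s *\<^sub>R d) - gradient f x)"
      by (rule norm_cauchy_schwarz)
    also have "\<dots> \<le> norm d * (L * norm (s *\<^sub>R d))"
      using L_smooth_gradient_lipschitz[OF f, of "x + s *\<^sub>R d" x] by (intro mult_left_mono) auto
    finally show ?thesis
      using that by (simp add: inner_diff_right power2_eq_square algebra_simps)
  qed
  ultimately have "f (x + 1 *\<^sub>R d) - f (x + 0 *\<^sub>R d) \<le>
      (1 * inner d (gradient f x) + L / 2 * 1\<^sup>2 * (norm d)\<^sup>2)
        - (0 * inner d (gradient f x) + L / 2 * 0\<^sup>2 * (norm d)\<^sup>2)"
    by (rule increment_le_of_derivative_le) auto
  then show ?thesis by simp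
qed

text \<open>
  A gradient step of length \<open>1 / L\<close> from \<open>x\<close> decreases \<open>f\<close> by at least
  \<open>(norm (gradient f x))\<^sup>2 / (2 * L)\<close>, and cannot go below the minimum.
\<close>

lemma L_smooth_gradient_le_gap:
  fixes f :: "'a::euclidean_space \<Rightarrow> real"
  assumes "L_smooth L f" "is_minimizer f xs" "0 < L"
  shows "(norm (gradient f x))\<^sup>2 / (2 * L) \<le> f x - f xs"
proof -
  let ?g = "gradient f x"
  have "f xs \<le> f (x + (- (1 / L)) *\<^sub>R ?g)"
    using assms(2) by (simp add: is_minimizer_def)
  also have "\<dots> \<le> f x + inner ((- (1 / L)) *\<^sub>R ?g) ?g + L / 2 * (norm ((- (1 / L)) *\<^sub>R ?g))\<^sup>2"
    by (rule L_smooth_descent[OF assms(1)])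
  also have "\<dots> = f x - (norm ?g)\<^sup>2 / (2 * L)"
    using assms(3) by (simp add: power_mult_distrib dot_square_norm power2_eq_square field_simps)
  finally show ?thesis by simp
qed

section \<open>Existence and uniqueness of the Hamiltonian flow\<close>

lemma hamiltonian_solution_unique:
  fixes f :: "'a::euclidean_space \<Rightarrow> real"
  assumes f: "L_smooth L f" and L: "0 \<le> L" "L * \<eta>\<^sup>2 \<le> 1"
    and sol: "hamiltonian_solution f \<eta> X Y" "hamiltonian_solution f \<eta> X' Y'"
    and init: "X 0 = X' 0" "Y 0 = Y' 0"
    and t: "t \<in> {0..\<eta>}"
  shows "X t = X' t" and "Y t = Y' t"
proof -
  let ?Z = "\<lambda>s. - gradient f (X s) - - gradient f (X' s)"
  have DX: "((\<lambda>s. X s - X' s) has_vector_derivative Y s - Y' s) (at s within {0..\<eta>})"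
    and DY: "((\<lambda>s. Y s - Y' s) has_vector_derivative ?Z s) (at s within {0..\<eta>})"
    if "s \<in> {0..\<eta>}" for s
    using sol that unfolding hamiltonian_solution_def
    by (blast intro: has_vector_derivative_diff)+
  have Z: "norm (?Z s) \<le> L * norm (X s - X' s) + 0" for s
    using L_smooth_gradient_lipschitz[OF f, of "X s" "X' s"]
    by (simp add: norm_minus_commute)
  have X: "X s = X' s" if "s \<in> {0..\<eta>}" for s
    using second_order_gronwall[OF DX DY _ _ Z L _ that] init by simp
  then show "X t = X' t" using t .
  have "norm (?Z s) \<le> 0 * s ^ 0" if "s \<in> {0..\<eta>}" for s
    using X[OF that] by simp
  from second_derivative_monomial_bound(1)[OF DX DY _ _ this t] init
  show "Y t = Y' t" by simp
qed

text \<open>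
  Solutions are the fixed points of the map that sends a path \<open>\<phi>\<close> to the path with initial
  data \<open>(x, v)\<close> and acceleration \<open>- gradient f \<circ> \<phi>\<close>. On \<open>[0, \<eta>]\<close> this map
  contracts the supremum distance by the factor \<open>L * \<eta>\<^sup>2 / 2 \<le> 1 / 2\<close>. Paths are
  extended beyond \<open>[0, \<eta>]\<close> by constants, so as to be bounded continuous functions on the
  whole line, which form a complete metric space.
\<close>

lemma hamiltonian_solution_exists:
  fixes f :: "'a::euclidean_space \<Rightarrow> real"
  assumes f: "L_smooth L f" and L: "0 \<le> L" "L * \<eta>\<^sup>2 \<le> 1" and \<eta>: "0 \<le> \<eta>"
  obtains X Y where "hamiltonian_solution f \<eta> X Y" "X 0 = x" "Y 0 = v"
proof -
  define V where "V \<phi> s = v - integral {0..s} (\<lambda>r. gradient f (\<phi> r))"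
    for \<phi> :: "real \<Rightarrow> 'a" and s
  define P where "P \<phi> s = x + integral {0..s} (V \<phi>)" for \<phi> s
  have DV: "(V \<phi> has_vector_derivative - gradient f (\<phi> s)) (at s within {0..\<eta>})"
    if "continuous_on {0..\<eta>} \<phi>" "s \<in> {0..\<eta>}" for \<phi> s
  proof -
    have "continuous_on {0..\<eta>} (\<lambda>r. gradient f (\<phi> r))"
      using continuous_on_compose2[OF L_smooth_continuous_on_gradient[OF f L(1)] that(1)] by blast
    from has_vector_derivative_diff[OF has_vector_derivative_const
        integral_has_vector_derivative[OF this that(2)]]
    show ?thesis by (simp add: V_def[abs_def])
  qed
  have DP: "(P \<phi> has_vector_derivative V \<phi> s) (at s within {0..\<eta>})"
    if "continuous_on {0..\<eta>} \<phi>" "s \<in> {0..\<eta>}" for \<phi> s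
  proof -
    have "continuous_on {0..\<eta>} (V \<phi>)"
      using DV[OF that(1)] by (meson continuous_on_vector_derivative)
    from has_vector_derivative_add[OF has_vector_derivative_const
        integral_has_vector_derivative[OF this that(2)]]
    show ?thesis by (simp add: P_def[abs_def])
  qed
  have "\<exists>\<psi>. \<forall>s. apply_bcontfun \<psi> s = P \<phi> (clamp 0 \<eta> s)" for \<phi> :: "real \<Rightarrow>\<^sub>C 'a"
  proof -
    have "continuous_on (cbox 0 \<eta>) (P \<phi>)"
      using DP[of \<phi>] by (metis continuous_on_apply_bcontfun continuous_on_vector_derivative
          cbox_interval)
    then show ?thesis by (metis continuous_on_cbox_bcontfunE)
  qed
  then obtain T :: "(real \<Rightarrow>\<^sub>C 'a) \<Rightarrow> (real \<Rightarrow>\<^sub>C 'a)"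
    where T: "\<And>\<phi> s. apply_bcontfun (T \<phi>) s = P \<phi> (clamp 0 \<eta> s)"
    by metis
  have "dist (T \<phi>) (T \<psi>) \<le> 1 / 2 * dist \<phi> \<psi>" for \<phi> \<psi>
  proof (rule dist_bound)
    fix s
    let ?s = "clamp 0 \<eta> s"
    let ?Z = "\<lambda>s. - gradient f (\<phi> s) - - gradient f (\<psi> s)"
    have s: "?s \<in> {0..\<eta>}"
      using clamp_in_interval[of 0 \<eta> s] \<eta> by (simp add: cbox_interval)
    have D: "((\<lambda>s. P \<phi> s - P \<psi> s) has_vector_derivative V \<phi> s - V \<psi> s) (at s within {0..\<eta>})"
      "((\<lambda>s. V \<phi> s - V \<psi> s) has_vector_derivative ?Z s) (at s within {0..\<eta>})"
      if "s \<in> {0..\<eta>}" for s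
      by (intro has_vector_derivative_diff DP DV that continuous_on_apply_bcontfun)+
    have Z: "norm (?Z s) \<le> (L * dist \<phi> \<psi>) * s ^ 0" for s
      using L_smooth_gradient_lipschitz[OF f, of "\<phi> s" "\<psi> s"]
        mult_left_mono[OF dist_bounded[of \<phi> s \<psi>] L(1)]
      by (simp add: norm_minus_commute dist_norm)
    have "norm (P \<phi> ?s - P \<psi> ?s) \<le> (L * dist \<phi> \<psi>) * ?s\<^sup>2 / 2"
      using second_derivative_monomial_bound(2)[OF D _ _ Z s]
      by (simp add: P_def V_def power2_eq_square)
    also have "\<dots> \<le> (L * dist \<phi> \<psi>) * \<eta>\<^sup>2 / 2"
      using s L by (intro divide_right_mono mult_left_mono power_mono) auto
    also have "\<dots> = (L * \<eta>\<^sup>2) * dist \<phi> \<psi> / 2" by simp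
    also have "\<dots> \<le> 1 * dist \<phi> \<psi> / 2"
      using L by (intro divide_right_mono mult_right_mono) auto
    finally show "dist (T \<phi> s) (T \<psi> s) \<le> 1 / 2 * dist \<phi> \<psi>"
      by (simp add: T dist_norm)
  qed
  then obtain \<phi> where "T \<phi> = \<phi>"
    using banach_fix_type[of "1 / 2" T] by auto
  then have eq: "apply_bcontfun \<phi> s = P \<phi> s" if "s \<in> {0..\<eta>}" for s
    using T[of \<phi> s] that by (simp add: cbox_interval)
  have "hamiltonian_solution f \<eta> (P \<phi>) (V \<phi>)"
    unfolding hamiltonian_solution_def
    using DP[of \<phi>] DV[of \<phi>] eq by auto
  then show thesis
    by (rule that) (simp_all add: P_def V_def)
qed

lemma HF_eq_of_hamiltonian_solution:
  fixes f :: "'a::euclidean_space \<Rightarrow> real"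
  assumes f: "L_smooth L f" and L: "0 \<le> L" "L * \<eta>\<^sup>2 \<le> 1" and \<eta>: "0 \<le> \<eta>"
    and sol: "hamiltonian_solution f \<eta> X Y"
  shows "HF f \<eta> (X 0, Y 0) = (X \<eta>, Y \<eta>)"
  unfolding HF_def
proof (rule the_equality)
  fix w assume "\<exists>X' Y'. hamiltonian_solution f \<eta> X' Y' \<and> (X' 0, Y' 0) = (X 0, Y 0) \<and> w = (X' \<eta>, Y' \<eta>)"
  then obtain X' Y' where *: "hamiltonian_solution f \<eta> X' Y'" "X' 0 = X 0" "Y' 0 = Y 0"
    and w: "w = (X' \<eta>, Y' \<eta>)" by blast
  show "w = (X \<eta>, Y \<eta>)"
    using hamiltonian_solution_unique[OF f L *(1) sol *(2,3), of \<eta>] w \<eta> by simp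
qed (use sol in blast)

section \<open>One step of the algorithm\<close>

text \<open>
  Over a time \<open>t\<close> with \<open>L * t\<^sup>2 \<le> 1\<close> the trajectory from rest stays near the parabola
  \<open>x - (t\<^sup>2 / 2) *\<^sub>R g\<close> with constant acceleration \<open>- g\<close>. The Gronwall estimate gives
  \<open>norm (X t - x) \<le> norm g * t\<^sup>2\<close>; feeding it once more into
  \<open>norm (gradient f (X t) - g) \<le> L * norm (X t - x)\<close> yields the constants below, since
  \<open>1 / 2 + 1 / 12 = 7 / 12\<close>, and integrating \<open>7 / 12 * L * t\<^sup>2\<close> gives \<open>7 / 36\<close>.
\<close>

lemma trajectory_from_rest_bounds:
  fixes f :: "'a::euclidean_space \<Rightarrow> real"
  assumes f: "L_smooth L f" and L: "0 \<le> L" "L * \<eta>\<^sup>2 \<le> 1"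
    and sol: "hamiltonian_solution f \<eta> X Y" and rest: "Y 0 = 0"
    and t: "t \<in> {0..\<eta>}"
  defines "g \<equiv> gradient f (X 0)"
  shows "norm (gradient f (X t) - g) \<le> 7 / 12 * L * norm g * t\<^sup>2"
    and "norm (Y t + t *\<^sub>R g) \<le> 7 / 36 * norm g * t"
proof -
  have DX: "(X has_vector_derivative Y s) (at s within {0..\<eta>})"
    and DY: "(Y has_vector_derivative - gradient f (X s)) (at s within {0..\<eta>})"
    if "s \<in> {0..\<eta>}" for s
    using sol that unfolding hamiltonian_solution_def by blast+
  have short: "L * s\<^sup>2 \<le> 1" if "s \<in> {0..\<eta>}" for s
  proof -
    have "L * s\<^sup>2 \<le> L * \<eta>\<^sup>2"
      using that L by (intro mult_left_mono power_mono) auto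
    with L show ?thesis by simp
  qed
  have grad: "norm (gradient f (X s) - g) \<le> L * norm (X s - X 0)" for s
    unfolding g_def by (rule L_smooth_gradient_lipschitz[OF f])

  have crude: "norm (X s - X 0) \<le> norm g * s\<^sup>2" if s: "s \<in> {0..\<eta>}" for s
  proof (rule second_order_gronwall[OF _ DY _ rest _ L _ s])
    show "((\<lambda>s. X s - X 0) has_vector_derivative Y s) (at s within {0..\<eta>})"
      if "s \<in> {0..\<eta>}" for s
      using DX[OF that] by (auto intro!: derivative_eq_intros)
    show "norm (- gradient f (X s)) \<le> L * norm (X s - X 0) + norm g" for s
      using grad[of s] norm_triangle_sub[of "gradient f (X s)" g] by simp
  qed auto

  \<comment> \<open>Subtracting the parabola leaves a path with acceleration \<open>g - gradient f (X s)\<close>.\<close>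
  define E where "E s = X s - X 0 + (s\<^sup>2 / 2) *\<^sub>R g" for s
  define E' where "E' s = Y s + s *\<^sub>R g" for s
  have DE: "(E has_vector_derivative E' s) (at s within {0..\<eta>})"
    and DE': "(E' has_vector_derivative g - gradient f (X s)) (at s within {0..\<eta>})"
    if "s \<in> {0..\<eta>}" for s
    unfolding E_def E'_def
    using DX[OF that] DY[OF that] by (auto intro!: derivative_eq_intros)
  have "norm (g - gradient f (X s)) \<le> (L * norm g) * s ^ 2" if "s \<in> {0..\<eta>}" for s
    using grad[of s] mult_left_mono[OF crude[OF that] L(1)]
    by (simp add: norm_minus_commute mult_ac)
  from second_derivative_monomial_bound(2)[OF DE DE' _ _ this]
  have E: "norm (E s) \<le> L * norm g * s ^ 4 / 12" if "s \<in> {0..\<eta>}" for s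
    using that by (simp add: E_def E'_def rest)

  have sharp: "norm (gradient f (X s) - g) \<le> 7 / 12 * L * norm g * s\<^sup>2" if s: "s \<in> {0..\<eta>}" for s
  proof -
    have "norm (X s - X 0) \<le> norm (E s) + norm ((s\<^sup>2 / 2) *\<^sub>R g)"
      using norm_triangle_ineq4[of "E s" "(s\<^sup>2 / 2) *\<^sub>R g"] by (simp add: E_def)
    also have "\<dots> \<le> L * norm g * s ^ 4 / 12 + s\<^sup>2 / 2 * norm g"
      using E[OF s] by simp
    also have "\<dots> = (L * s\<^sup>2) * (norm g * s\<^sup>2) / 12 + norm g * s\<^sup>2 / 2"
      by (simp add: power2_eq_square power4_eq_xxxx mult_ac)
    also have "\<dots> \<le> 1 * (norm g * s\<^sup>2) / 12 + norm g * s\<^sup>2 / 2"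
      using short[OF s] by (intro add_right_mono divide_right_mono mult_right_mono) auto
    finally have "norm (X s - X 0) \<le> 7 / 12 * (norm g * s\<^sup>2)" by simp
    from mult_left_mono[OF this L(1)] grad[of s] show ?thesis by (simp add: mult_ac)
  qed
  then show "norm (gradient f (X t) - g) \<le> 7 / 12 * L * norm g * t\<^sup>2" using t .

  have "norm (g - gradient f (X s)) \<le> (7 / 12 * L * norm g) * s ^ 2" if "s \<in> {0..\<eta>}" for s
    using sharp[OF that] by (simp add: norm_minus_commute)
  from second_derivative_monomial_bound(1)[OF DE DE' _ _ this t]
  have "norm (E' t) \<le> 7 / 12 * L * norm g * t ^ 3 / 3"
    by (simp add: E_def E'_def rest eval_nat_numeral)
  also have "\<dots> = 7 / 36 * (L * t\<^sup>2) * (norm g * t)"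
    by (simp add: power2_eq_square power3_eq_cube)
  also have "\<dots> \<le> 7 / 36 * 1 * (norm g * t)"
    using short[OF t] t by (intro mult_right_mono mult_left_mono) auto
  finally show "norm (Y t + t *\<^sub>R g) \<le> 7 / 36 * norm g * t"
    by (simp add: E'_def)
qed

lemma energy_conservation:
  fixes f :: "'a::euclidean_space \<Rightarrow> real"
  assumes f: "L_smooth L f" and sol: "hamiltonian_solution f \<eta> X Y" and t: "t \<in> {0..\<eta>}"
  shows "f (X t) + (norm (Y t))\<^sup>2 / 2 = f (X 0) + (norm (Y 0))\<^sup>2 / 2"
proof -
  let ?H = "\<lambda>s. f (X s) + inner (Y s) (Y s) / 2"
  have "(?H has_vector_derivative 0) (at s within {0..\<eta>})" if "s \<in> {0..\<eta>}" for s
  proof -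
    have D: "(X has_vector_derivative Y s) (at s within {0..\<eta>})"
      "(Y has_vector_derivative - gradient f (X s)) (at s within {0..\<eta>})"
      using sol that unfolding hamiltonian_solution_def by blast+
    have "((\<lambda>s. f (X s)) has_real_derivative inner (Y s) (gradient f (X s))) (at s within {0..\<eta>})"
      by (rule has_real_derivative_along_curve[OF L_smooth_GDERIV[OF f] D(1)])
    moreover have "((\<lambda>s. inner (Y s) (Y s)) has_real_derivative
        - 2 * inner (Y s) (gradient f (X s))) (at s within {0..\<eta>})"
      using has_derivative_inner[OF D(2,2)[unfolded has_vector_derivative_def]]
      unfolding has_field_derivative_def
      by (rule has_derivative_eq_rhs) (simp add: fun_eq_iff inner_commute algebra_simps)
    ultimately show ?thesis
      by (auto intro!: derivative_eq_intros simp flip: has_real_derivative_iff_has_vector_derivative)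
  qed
  moreover have "((\<lambda>s. 0) has_real_derivative 0) (at s)" for s :: real
    by simp
  ultimately have "norm (?H t - ?H 0) \<le> 0 - 0"
    by (rule norm_increment_le_of_derivative_le) (use t in auto)
  then show ?thesis by (simp add: dot_square_norm)
qed

text \<open>
  All potential energy that is lost becomes kinetic energy, and the final velocity is close
  to \<open>- \<eta> *\<^sub>R gradient f (X 0)\<close>: its norm is at least \<open>29 / 36 * \<eta> * norm (gradient f (X 0))\<close>,
  and \<open>(29 / 36)\<^sup>2 \<ge> 1 / 2\<close>.
\<close>

lemma sufficient_decrease:
  fixes f :: "'a::euclidean_space \<Rightarrow> real"
  assumes f: "L_smooth L f" and L: "0 \<le> L" "L * \<eta>\<^sup>2 \<le> 1" and \<eta>: "0 \<le> \<eta>"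
    and sol: "hamiltonian_solution f \<eta> X Y" and rest: "Y 0 = 0"
  shows "f (X \<eta>) \<le> f (X 0) - \<eta>\<^sup>2 * (norm (gradient f (X 0)))\<^sup>2 / 4"
proof -
  let ?g = "gradient f (X 0)"
  have "norm (\<eta> *\<^sub>R ?g) \<le> norm (Y \<eta> + \<eta> *\<^sub>R ?g) + norm (Y \<eta>)"
    using norm_triangle_ineq4[of "Y \<eta> + \<eta> *\<^sub>R ?g" "Y \<eta>"] by simp
  then have "29 / 36 * (\<eta> * norm ?g) \<le> norm (Y \<eta>)"
    using trajectory_from_rest_bounds(2)[OF f L sol rest, of \<eta>] \<eta> by (simp add: mult_ac)
  then have "(29 / 36 * (\<eta> * norm ?g))\<^sup>2 \<le> (norm (Y \<eta>))\<^sup>2"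
    using \<eta> by (intro power_mono) auto
  moreover have "1 / 2 * (\<eta> * norm ?g)\<^sup>2 \<le> (29 / 36)\<^sup>2 * (\<eta> * norm ?g)\<^sup>2"
    by (intro mult_right_mono) (auto simp: power2_eq_square)
  ultimately have "\<eta>\<^sup>2 * (norm ?g)\<^sup>2 / 2 \<le> (norm (Y \<eta>))\<^sup>2"
    unfolding power_mult_distrib by simp
  then show ?thesis
    using energy_conservation[OF f sol, of \<eta>] \<eta> rest by simp
qed

text \<open>
  The second derivative of \<open>(norm (X t - xs))\<^sup>2 / 2\<close> is
  \<open>(norm (Y t))\<^sup>2 - inner (gradient f (X t)) (X t - xs)\<close>. By convexity and smoothness the
  subtracted term is at least \<open>(norm (gradient f (X t)))\<^sup>2 / (2 * L)\<close>. With \<open>g\<close> the gradient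
  at \<open>X 0\<close> and the bounds on the trajectory, the second derivative is therefore at most
  \<open>(norm g)\<^sup>2 * (3 * t\<^sup>2 - 1 / (2 * L))\<close>. This bound becomes positive for \<open>t\<close> near \<open>1 / sqrt L\<close>,
  but its double integral \<open>(norm g)\<^sup>2 * (t\<^sup>2 / 4) * (t\<^sup>2 - 1 / L)\<close> does not.
\<close>

lemma distance_to_minimizer_nonincreasing:
  fixes f :: "'a::euclidean_space \<Rightarrow> real"
  assumes f: "L_smooth L f" "is_minimizer f xs" "weakly_convex f"
    and L: "0 < L" "L * \<eta>\<^sup>2 \<le> 1" and \<eta>: "0 \<le> \<eta>"
    and sol: "hamiltonian_solution f \<eta> X Y" and rest: "Y 0 = 0"
  shows "norm (X \<eta> - xs) \<le> norm (X 0 - xs)"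
proof -
  define G where "G = norm (gradient f (X 0))"
  have DX: "(X has_vector_derivative Y s) (at s within {0..\<eta>})"
    and DY: "(Y has_vector_derivative - gradient f (X s)) (at s within {0..\<eta>})"
    if "s \<in> {0..\<eta>}" for s
    using sol that unfolding hamiltonian_solution_def by blast+
  define q where "q s = inner (Y s) (X s - xs)" for s
  define q' where "q' s = (norm (Y s))\<^sup>2 - inner (gradient f (X s)) (X s - xs)" for s
  have DXs: "((\<lambda>s. X s - xs) has_derivative (\<lambda>u. u *\<^sub>R Y s)) (at s within {0..\<eta>})"
    if "s \<in> {0..\<eta>}" for s
    using DX[OF that] unfolding has_vector_derivative_def by (auto intro!: derivative_eq_intros)
  have Dp: "((\<lambda>s. inner (X s - xs) (X s - xs) / 2) has_real_derivative q s) (at s within {0..\<eta>})"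
    and Dq: "(q has_real_derivative q' s) (at s within {0..\<eta>})" if "s \<in> {0..\<eta>}" for s
  proof -
    have "((\<lambda>s. inner (X s - xs) (X s - xs)) has_real_derivative 2 * q s) (at s within {0..\<eta>})"
      using has_derivative_inner[OF DXs DXs, OF that that] unfolding has_field_derivative_def
      by (rule has_derivative_eq_rhs) (simp add: q_def fun_eq_iff inner_commute)
    from DERIV_cdivide[OF this, of 2]
    show "((\<lambda>s. inner (X s - xs) (X s - xs) / 2) has_real_derivative q s) (at s within {0..\<eta>})"
      by simp
    show "(q has_real_derivative q' s) (at s within {0..\<eta>})"
      using has_derivative_inner[OF DY[OF that, unfolded has_vector_derivative_def] DXs[OF that]]
      unfolding has_field_derivative_def q_def[abs_def]
      by (rule has_derivative_eq_rhs) (simp add: q'_def fun_eq_iff dot_square_norm algebra_simps)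
  qed

  have q'_le: "q' s \<le> G\<^sup>2 * (3 * s\<^sup>2 - 1 / (2 * L))" if s: "s \<in> {0..\<eta>}" for s
  proof -
    let ?g = "gradient f (X s)"
    note bounds = trajectory_from_rest_bounds[OF f(1) less_imp_le[OF L(1)] L(2) sol rest s,
        folded G_def]
    have "norm (Y s) \<le> norm (Y s + s *\<^sub>R gradient f (X 0)) + norm (s *\<^sub>R gradient f (X 0))"
      using norm_triangle_ineq4[of "Y s + s *\<^sub>R gradient f (X 0)" "s *\<^sub>R gradient f (X 0)"] by simp
    then have "norm (Y s) \<le> 43 / 36 * (G * s)"
      using bounds(2) s by (simp add: G_def mult_ac)
    then have "(norm (Y s))\<^sup>2 \<le> (43 / 36 * (G * s))\<^sup>2"
      by (intro power_mono) auto
    also have "\<dots> = (43 / 36)\<^sup>2 * (G\<^sup>2 * s\<^sup>2)"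
      by (simp only: power_mult_distrib)
    finally have Y: "(norm (Y s))\<^sup>2 \<le> (43 / 36)\<^sup>2 * (G\<^sup>2 * s\<^sup>2)" .

    have "L * s\<^sup>2 \<le> L * \<eta>\<^sup>2"
      using s L by (intro mult_left_mono power_mono) auto
    then have short: "L * s\<^sup>2 \<le> 1" using L(2) by linarith
    have "G \<le> norm ?g + norm (?g - gradient f (X 0))"
      using norm_triangle_sub[of "gradient f (X 0)" ?g] by (simp add: G_def norm_minus_commute)
    then have "G * (1 - 7 / 12 * (L * s\<^sup>2)) \<le> norm ?g"
      using bounds(1) by (simp add: algebra_simps)
    then have "(G * (1 - 7 / 12 * (L * s\<^sup>2)))\<^sup>2 \<le> (norm ?g)\<^sup>2"
      using short by (intro power_mono) (auto simp: G_def)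
    moreover have "G\<^sup>2 * (1 - 7 / 6 * (L * s\<^sup>2)) \<le> (G * (1 - 7 / 12 * (L * s\<^sup>2)))\<^sup>2"
      unfolding power_mult_distrib using zero_le_power2[of "7 / 12 * (L * s\<^sup>2)"]
      by (intro mult_left_mono) (simp_all add: power2_diff)
    ultimately have "G\<^sup>2 * (1 - 7 / 6 * (L * s\<^sup>2)) / (2 * L) \<le> (norm ?g)\<^sup>2 / (2 * L)"
      using L by (intro divide_right_mono) auto
    also have "\<dots> \<le> f (X s) - f xs"
      by (rule L_smooth_gradient_le_gap[OF f(1,2) L(1)])
    also have "\<dots> \<le> inner ?g (X s - xs)"
    proof -
      have "f (X s) + inner ?g (xs - X s) \<le> f xs"
        using f(3) unfolding weakly_convex_def by blast
      then show ?thesis by (simp add: inner_diff_right)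
    qed
    also have "G\<^sup>2 * (1 - 7 / 6 * (L * s\<^sup>2)) / (2 * L) = G\<^sup>2 / (2 * L) - 7 / 12 * (G\<^sup>2 * s\<^sup>2)"
      using L by (simp add: field_simps)
    finally have "q' s \<le> ((43 / 36)\<^sup>2 + 7 / 12) * (G\<^sup>2 * s\<^sup>2) - G\<^sup>2 / (2 * L)"
      using Y unfolding q'_def distrib_right by linarith
    \<comment> \<open>The constant is about \<open>2.01\<close>; \<open>3\<close> is the largest value for which the double
      integral below remains nonpositive up to \<open>L * \<eta>\<^sup>2 = 1\<close>.\<close>
    also have "\<dots> \<le> 3 * (G\<^sup>2 * s\<^sup>2) - G\<^sup>2 / (2 * L)"
      by (intro diff_right_mono mult_right_mono) (auto simp: power2_eq_square)
    finally show ?thesis by (simp add: algebra_simps)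
  qed

  have q_le: "q s \<le> G\<^sup>2 * (s ^ 3 - s / (2 * L))" if "s \<in> {0..\<eta>}" for s
  proof -
    have "((\<lambda>s. G\<^sup>2 * (s ^ 3 - s / (2 * L))) has_real_derivative G\<^sup>2 * (3 * s\<^sup>2 - 1 / (2 * L))) (at s)"
      for s
      using L by (auto intro!: derivative_eq_intros)
    from increment_le_of_derivative_le[OF Dq this q'_le that] show ?thesis
      by (simp add: q_def rest)
  qed
  have "((\<lambda>s. G\<^sup>2 * (s ^ 4 / 4 - s\<^sup>2 / (4 * L))) has_real_derivative G\<^sup>2 * (s ^ 3 - s / (2 * L))) (at s)"
    for s
    using L by (auto intro!: derivative_eq_intros)
  from increment_le_of_derivative_le[OF Dp this q_le, of \<eta>] \<eta>
  have "(norm (X \<eta> - xs))\<^sup>2 / 2 - (norm (X 0 - xs))\<^sup>2 / 2 \<le> G\<^sup>2 * (\<eta> ^ 4 / 4 - \<eta>\<^sup>2 / (4 * L))"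
    by (simp add: dot_square_norm)
  also have "\<dots> = (G\<^sup>2 * \<eta>\<^sup>2 / (4 * L)) * (L * \<eta>\<^sup>2 - 1)"
    using L by (simp add: field_simps power2_eq_square power4_eq_xxxx)
  also have "\<dots> \<le> 0"
    using L by (intro mult_nonneg_nonpos) auto
  finally have "(norm (X \<eta> - xs))\<^sup>2 \<le> (norm (X 0 - xs))\<^sup>2" by simp
  then show ?thesis by (rule power2_le_imp_le) simp
qed

section \<open>Convergence rates\<close>

lemma HF_opt_step:
  fixes f :: "'a::euclidean_space \<Rightarrow> real"
  assumes f: "L_smooth L f" and L: "0 \<le> L" "L * (\<eta> k)\<^sup>2 \<le> 1" and \<eta>: "0 \<le> \<eta> k"
  obtains X Y where "hamiltonian_solution f (\<eta> k) X Y" "Y 0 = 0"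
    "X 0 = HF_opt f \<eta> x0 k" "X (\<eta> k) = HF_opt f \<eta> x0 (Suc k)"
proof -
  obtain X Y where sol: "hamiltonian_solution f (\<eta> k) X Y"
    and init: "X 0 = HF_opt f \<eta> x0 k" "Y 0 = 0"
    using hamiltonian_solution_exists[OF f L \<eta>] by blast
  show thesis
    using HF_eq_of_hamiltonian_solution[OF f L \<eta> sol] init by (intro that[OF sol]) auto
qed

text \<open>
  The decrease \<open>\<delta>\<^sub>k - \<delta>\<^sub>k\<^sub>+\<^sub>1 \<ge> \<delta>\<^sub>k\<^sup>2 / A\<close> increases \<open>1 / \<delta>\<^sub>k\<close> by at
  least \<open>1 / A\<close> per step. The statement and the proof avoid the reciprocals, so that vanishing
  \<open>A\<close> and \<open>\<delta> k\<close> are covered.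
\<close>

lemma inverse_linear_decay:
  fixes \<delta> :: "nat \<Rightarrow> real"
  assumes A: "0 \<le> A" and nonneg: "\<And>k. 0 \<le> \<delta> k" and mono: "\<And>k. \<delta> (Suc k) \<le> \<delta> k"
    and decrease: "\<And>k. (\<delta> k)\<^sup>2 \<le> A * (\<delta> k - \<delta> (Suc k))"
  shows "real k * \<delta> k \<le> A"
proof (induction k)
  case (Suc k)
  have "\<delta> k * \<delta> (Suc k) \<le> (\<delta> k)\<^sup>2"
    using mult_left_mono[OF mono nonneg] by (simp add: power2_eq_square)
  then have step: "\<delta> (Suc k) * (A + \<delta> k) \<le> A * \<delta> k"
    using decrease[of k] by (simp add: algebra_simps)
  have "real (Suc k) * \<delta> (Suc k) * (A + \<delta> k) \<le> real (Suc k) * (A * \<delta> k)"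
    using mult_left_mono[OF step, of "real (Suc k)"] by (simp add: mult.assoc)
  also have "\<dots> = A * (real k * \<delta> k + \<delta> k)"
    by (simp add: algebra_simps)
  also have "\<dots> \<le> A * (A + \<delta> k)"
    using Suc A by (intro mult_left_mono) auto
  finally have le: "real (Suc k) * \<delta> (Suc k) * (A + \<delta> k) \<le> A * (A + \<delta> k)" .
  show ?case
  proof (cases "A + \<delta> k = 0")
    case True
    then have "\<delta> (Suc k) = 0"
      using A nonneg[of k] nonneg[of "Suc k"] mono[of k] by linarith
    with A show ?thesis by simp
  next
    case False
    then have "0 < A + \<delta> k"
      using A nonneg[of k] by linarith
    with le show ?thesis by (rule mult_right_le_imp_le)
  qed
qed (use A in simp)

lemma HF_opt_gradient_dominated_rate:
  fixes f :: "'a::euclidean_space \<Rightarrow> real" and x0 :: 'a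
  assumes f: "L_smooth L f" "gradient_dominated \<alpha> f xs" and L: "0 \<le> L" "L * h\<^sup>2 \<le> 1"
    and h: "0 \<le> h" and \<alpha>: "\<alpha> * h\<^sup>2 \<le> 2"
  defines "x \<equiv> HF_opt f (\<lambda>k. h) x0"
  shows "f (x k) - f xs \<le> (1 - 1 / 2 * \<alpha> * h\<^sup>2) ^ k * (f x0 - f xs)"
proof (induction k)
  case 0
  show ?case by (simp add: x_def)
next
  case (Suc k)
  obtain X Y where sol: "hamiltonian_solution f h X Y" "Y 0 = 0"
    and X: "X 0 = x k" "X h = x (Suc k)"
    using HF_opt_step[OF f(1) L(1), of "\<lambda>k. h" k x0] L(2) h unfolding x_def by blast
  have "f (x (Suc k)) \<le> f (x k) - h\<^sup>2 * (norm (gradient f (x k)))\<^sup>2 / 4"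
    using sufficient_decrease[OF f(1) L h sol] by (simp add: X)
  moreover have "h\<^sup>2 * (2 * \<alpha> * (f (x k) - f xs)) / 4 \<le> h\<^sup>2 * (norm (gradient f (x k)))\<^sup>2 / 4"
    using f(2) unfolding gradient_dominated_def by (intro divide_right_mono mult_left_mono) auto
  ultimately have "f (x (Suc k)) \<le> f (x k) - h\<^sup>2 * (2 * \<alpha> * (f (x k) - f xs)) / 4"
    by linarith
  then have "f (x (Suc k)) - f xs \<le> (1 - 1 / 2 * \<alpha> * h\<^sup>2) * (f (x k) - f xs)"
    by (simp add: field_simps)
  also have "\<dots> \<le> (1 - 1 / 2 * \<alpha> * h\<^sup>2) * ((1 - 1 / 2 * \<alpha> * h\<^sup>2) ^ k * (f x0 - f xs))"
    using Suc \<alpha> by (intro mult_left_mono) auto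
  finally show ?case by (simp add: mult.assoc)
qed

lemma HF_opt_convex_rate:
  fixes f :: "'a::euclidean_space \<Rightarrow> real" and x0 :: 'a
  assumes f: "L_smooth L f" "is_minimizer f xs" "weakly_convex f" and L: "0 < L" "L * h\<^sup>2 \<le> 1"
    and h: "0 < h" and k: "1 \<le> k"
  defines "x \<equiv> HF_opt f (\<lambda>k. h) x0"
  shows "f (x k) - f xs \<le> 4 * (norm (x0 - xs))\<^sup>2 / (h\<^sup>2 * real k)"
proof -
  define D where "D = norm (x0 - xs)"
  define \<delta> where "\<delta> k = f (x k) - f xs" for k
  have decrease: "f (x (Suc k)) \<le> f (x k) - h\<^sup>2 * (norm (gradient f (x k)))\<^sup>2 / 4"
    and distance: "norm (x (Suc k) - xs) \<le> norm (x k - xs)" for k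
  proof -
    obtain X Y where sol: "hamiltonian_solution f h X Y" "Y 0 = 0"
      and X: "X 0 = x k" "X h = x (Suc k)"
      using HF_opt_step[OF f(1), of "\<lambda>k. h" k x0] L h unfolding x_def by auto
    show "f (x (Suc k)) \<le> f (x k) - h\<^sup>2 * (norm (gradient f (x k)))\<^sup>2 / 4"
      using sufficient_decrease[OF f(1) _ L(2) _ sol] L h by (simp add: X)
    show "norm (x (Suc k) - xs) \<le> norm (x k - xs)"
      using distance_to_minimizer_nonincreasing[OF f L _ sol] h by (simp add: X)
  qed
  have D: "norm (x k - xs) \<le> D" for k
    by (induction k) (use distance in \<open>auto simp: D_def x_def intro: order_trans\<close>)
  have nonneg: "0 \<le> \<delta> k" for k
    using f(2) by (simp add: is_minimizer_def \<delta>_def)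
  have mono: "\<delta> (Suc k) \<le> \<delta> k" for k
  proof -
    have "0 \<le> h\<^sup>2 * (norm (gradient f (x k)))\<^sup>2 / 4" by simp
    with decrease[of k] show ?thesis unfolding \<delta>_def by linarith
  qed
  have "(\<delta> k)\<^sup>2 \<le> 4 * D\<^sup>2 / h\<^sup>2 * (\<delta> k - \<delta> (Suc k))" for k
  proof -
    let ?g = "gradient f (x k)"
    have "f (x k) + inner ?g (xs - x k) \<le> f xs"
      using f(3) unfolding weakly_convex_def by blast
    then have "\<delta> k \<le> inner ?g (x k - xs)"
      by (simp add: \<delta>_def inner_diff_right)
    also have "\<dots> \<le> norm ?g * norm (x k - xs)"
      by (rule norm_cauchy_schwarz)
    also have "\<dots> \<le> norm ?g * D"
      by (intro mult_left_mono D) simp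
    finally have "(\<delta> k)\<^sup>2 \<le> (norm ?g * D)\<^sup>2"
      by (intro power_mono nonneg)
    also have "\<dots> = 4 * D\<^sup>2 / h\<^sup>2 * (h\<^sup>2 * (norm ?g)\<^sup>2 / 4)"
      using h by (simp add: power_mult_distrib)
    also have "\<dots> \<le> 4 * D\<^sup>2 / h\<^sup>2 * (\<delta> k - \<delta> (Suc k))"
      using decrease[of k] by (intro mult_left_mono) (auto simp: \<delta>_def)
    finally show ?thesis .
  qed
  then have "real k * \<delta> k \<le> 4 * D\<^sup>2 / h\<^sup>2"
    by (intro inverse_linear_decay nonneg mono) auto
  then show ?thesis
    using k h by (simp add: \<delta>_def D_def field_simps)
qed

theorem theorem1:
  fixes f :: "real ^ 'd \<Rightarrow> real" and xs x0 :: "real ^ 'd"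
    and L h :: real and x :: "nat \<Rightarrow> real ^ 'd"
  assumes "L \<ge> 1"
    and "L_smooth L f"
    and "is_minimizer f xs"
    and "0 < h" and "h \<le> 1 / sqrt L"
    and "x = HF_opt f (\<lambda>k. h) x0"
  shows "(\<forall>\<alpha>. 0 < \<alpha> \<and> \<alpha> \<le> 1 \<and> gradient_dominated \<alpha> f xs \<longrightarrow>
            (\<forall>k. f (x k) - f xs \<le> (1 - 1/2 * \<alpha> * h\<^sup>2) ^ k * (f x0 - f xs)))
       \<and> (weakly_convex f \<longrightarrow>
            (\<forall>k\<ge>1. f (x k) - f xs \<le> 34 * (norm (x0 - xs))\<^sup>2 / (h\<^sup>2 * real k)))"
proof (intro conjI allI impI)
  have "h\<^sup>2 \<le> (1 / sqrt L)\<^sup>2"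
    using assms(4,5) by (intro power_mono) auto
  then have Lh: "L * h\<^sup>2 \<le> 1"
    using assms(1) by (simp add: power_divide field_simps)
  {
    fix \<alpha> k assume \<alpha>: "0 < \<alpha> \<and> \<alpha> \<le> 1 \<and> gradient_dominated \<alpha> f xs"
    have "\<alpha> * h\<^sup>2 \<le> L * h\<^sup>2"
      using \<alpha> assms(1) by (intro mult_right_mono) auto
    with Lh have "\<alpha> * h\<^sup>2 \<le> 2" by linarith
    then show "f (x k) - f xs \<le> (1 - 1/2 * \<alpha> * h\<^sup>2) ^ k * (f x0 - f xs)"
      unfolding assms(6) using \<alpha> assms(1,2,4) Lh
      by (intro HF_opt_gradient_dominated_rate[where L = L]) auto
  next
    fix k :: nat assume k: "1 \<le> k" and "weakly_convex f"
    then have "f (x k) - f xs \<le> 4 * (norm (x0 - xs))\<^sup>2 / (h\<^sup>2 * real k)"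
      unfolding assms(6) using assms(1-4) Lh
      by (intro HF_opt_convex_rate[where L = L]) auto
    also have "\<dots> \<le> 34 * (norm (x0 - xs))\<^sup>2 / (h\<^sup>2 * real k)"
      by (intro divide_right_mono mult_right_mono) auto
    finally show "f (x k) - f xs \<le> 34 * (norm (x0 - xs))\<^sup>2 / (h\<^sup>2 * real k)" .
  }
qed

end
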